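(* Let $S_1,S_2\subset\mathbb{R}$ contain all terms of lacunary sequences $(b_i)_{i\ge1}$ and $(d_j)_{j\ge1}$ in $(0,\infty)$, respectively, with $-\log b_i=o(i^2)$ and $-\log d_j=o(j^2)$. Then $S_1+S_2$ and $S_1-S_2$ are not measure universal. In particular: (1) if $S\subset\mathbb{R}$ contains all terms of a lacunary sequence $(b_k)_{k\ge1}\subset(0,\infty)$ with $-\log b_k=o(k^2)$, then $S+S$ and $S-S$ are not measure universal; (2) every geometric double sumset $\{ar^n:n\ge1\}+\{ar^n:n\ge1\}$, with $a\ne0$ and $0<|r|<1$, is not measure universal; (3) for every $\alpha\in(0,2)$, the set $\{2^{-n^{\alpha}}:n\ge1\}+\{2^{-n^{\alpha}}:n\ge1\}$ is not measure universal.
   Context: A set $E\subset\mathbb{R}$ is measure universal if for every Lebesgue measurable $L\subset\mathbb{R}$ of positive Lebesgue measure there exist $x\in\mathbb{R}$ and $\lambda\neq0$ with $x+\lambda E\subset L$. A sequence $(b_i)_{i\ge1}\subset(0,\infty)$ is lacunary with ratio $q\in(0,1)$ if $b_{i+1}\le q\,b_i$ for all $i$; it is lacunary if this holds for some $q\in(0,1)$. For sets $X,Y\subset\mathbb{R}$, $X\pm Y=\{x\pm y: x\in X,\ y\in Y\}$. *)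

theory Defs
  imports "HOL-Analysis.Analysis" "HOL-Library.Set_Algebras" "HOL-Library.Landau_Symbols"
begin

definition measure_universal :: "real set \<Rightarrow> bool" where
  "measure_universal E \<longleftrightarrow>
     (\<forall>L \<in> sets lebesgue. emeasure lebesgue L > 0 \<longrightarrow>
        (\<exists>x c. c \<noteq> 0 \<and> (\<lambda>e. x + c * e) ` E \<subseteq> L))"

text \<open>Sequences are indexed from 1; the value at index 0 is irrelevant.\<close>

definition lacunary_with_ratio :: "real \<Rightarrow> (nat \<Rightarrow> real) \<Rightarrow> bool" where
  "lacunary_with_ratio q b \<longleftrightarrow>
     0 < q \<and> q < 1 \<and> (\<forall>i\<ge>1. b i > 0) \<and> (\<forall>i\<ge>1. b (i + 1) \<le> q * b i)"

definition lacunary :: "(nat \<Rightarrow> real) \<Rightarrow> bool" where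
  "lacunary b \<longleftrightarrow> (\<exists>q. lacunary_with_ratio q b)"

text \<open>The elementwise sum of sets is the operation \<open>+\<close> of \<^theory>\<open>HOL-Library.Set_Algebras\<close>.
  The elementwise difference needs its own name, since \<open>-\<close> on sets is set-theoretic difference.\<close>

definition difference_set :: "real set \<Rightarrow> real set \<Rightarrow> real set" where
  "difference_set X Y = {x - y | x y. x \<in> X \<and> y \<in> Y}"

end

theory Submission
  imports Defs "HOL-Real_Asymp.Real_Asymp"
begin

text \<open>Following Kolountzakis, a set \<open>A\<close> is not measure universal as soon as it contains finite subsets of
  \<open>n\<close> points, \<open>n\<close> arbitrarily large, with mutual gaps at least \<open>g\<close> where \<open>- ln g = o(n)\<close>. Cut \<open>[0,1]\<close> into
  about \<open>1/g\<close> cells. Up to rounding, the copies \<open>x + t F\<close> with \<open>1/K \<le> \<bar>t\<bar> \<le> K\<close> give only \<open>O(1/g\<^sup>2)\<close> patterns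
  of \<open>n\<close> distinct cells, and a random choice of a proportion \<open>\<epsilon>\<close> of the cells misses a given pattern with
  probability at most \<open>exp (- \<epsilon> n)\<close>; hence some choice meets all patterns. Removing such sets for
  \<open>K \<rightarrow> \<infinity>\<close> with summable \<open>\<epsilon>\<close> leaves a set of positive measure without affine copies of \<open>A\<close>.
  For two lacunary sequences, thinned to ratio at most \<open>1/4\<close>, about half of the \<open>N\<^sup>2\<close> sums
  \<open>\<plusminus> b i \<plusminus> d j\<close> are separated by a multiple of the \<open>N\<close>-th terms, which is \<open>exp (- o(N\<^sup>2))\<close>.\<close>

section \<open>Small sets meeting all affine copies of a separated finite set\<close>

text \<open>A union bound by counting: of the \<open>card G ^ m\<close> ways to draw
  \<open>m\<close> points with replacement, at most
  \<open>exp (- (n * m / card G)) * card G ^ m\<close> miss a given \<open>C\<close>, so by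
  \<open>few\<close> some draw meets every \<open>C\<close>. Repetitions only shrink the range of
  the draw.\<close>

lemma exists_hitting_set:
  fixes G :: "'a set" and \<C> :: "'a set set" and n m :: nat
  assumes "finite G" "G \<noteq> {}" "finite \<C>"
    and sub: "\<And>C. C \<in> \<C> \<Longrightarrow> C \<subseteq> G" and large: "\<And>C. C \<in> \<C> \<Longrightarrow> n \<le> card C"
    and few: "card \<C> < exp (n * m / card G)"
  shows "\<exists>H \<subseteq> G. card H \<le> m \<and> (\<forall>C \<in> \<C>. C \<inter> H \<noteq> {})"
proof -
  let ?V = "{..<m} \<rightarrow>\<^sub>E G"
  let ?B = "\<Union>C\<in>\<C>. ({..<m} \<rightarrow>\<^sub>E (G - C))"
  have G0: "card G > 0"
    using assms by (simp add: card_gt_0_iff)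
  have each: "real (card ({..<m} \<rightarrow>\<^sub>E (G - C))) \<le> exp (- (n * m / card G)) * card G ^ m"
    if C: "C \<in> \<C>" for C
  proof -
    have "real (card (G - C)) = card G - card C"
      using sub[OF C] assms(1) by (simp add: card_Diff_subset finite_subset card_mono)
    also have "\<dots> \<le> (1 - n / card G) * card G"
      using large[OF C] G0 card_mono[OF assms(1) sub[OF C]] by (simp add: left_diff_distrib)
    also have "\<dots> \<le> exp (- (n / card G)) * card G"
      using exp_ge_add_one_self[of "- (n / card G)"] by (intro mult_right_mono) auto
    finally have "real (card (G - C)) ^ m \<le> (exp (- (n / card G)) * card G) ^ m"
      by (intro power_mono) auto
    also have "\<dots> = exp (- (n * m / card G)) * card G ^ m"
      by (simp add: power_mult_distrib flip: exp_of_nat_mult)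
    finally show ?thesis
      by (simp add: card_PiE)
  qed
  have "real (card ?B) \<le> (\<Sum>C\<in>\<C>. real (card ({..<m} \<rightarrow>\<^sub>E (G - C))))"
    using card_UN_le[OF assms(3), of "\<lambda>C. {..<m} \<rightarrow>\<^sub>E (G - C)"] by (simp flip: of_nat_sum)
  also have "\<dots> \<le> card \<C> * (exp (- (n * m / card G)) * card G ^ m)"
    using sum_bounded_above[of \<C>, OF each] by simp
  also have "\<dots> = (card \<C> * exp (- (n * m / card G))) * card G ^ m"
    by simp
  also have "\<dots> < 1 * real (card G ^ m)"
    using few G0 by (intro mult_strict_right_mono) (auto simp: exp_minus field_simps)
  also have "\<dots> = real (card ?V)"
    by (simp add: card_PiE)
  finally have "card ?B < card ?V"
    by simp
  moreover have "finite ?V" "finite ?B"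
    using assms by (auto intro!: finite_PiE)
  ultimately have "\<not> ?V \<subseteq> ?B"
    using card_mono linorder_not_less by blast
  then obtain f where f: "f \<in> ?V" "f \<notin> ?B"
    by blast
  have "C \<inter> f ` {..<m} \<noteq> {}" if "C \<in> \<C>" for C
    using f that by (auto simp: PiE_iff)
  moreover have "card (f ` {..<m}) \<le> m"
    using card_image_le[of "{..<m}" f] by simp
  moreover have "f ` {..<m} \<subseteq> G"
    using f(1) by auto
  ultimately show ?thesis
    by blast
qed

text \<open>A single \<open>U\<close> works for all real \<open>x\<close> and all scales between
  \<open>1 / K\<close> and \<open>K\<close>, because after rounding only finitely many cell patterns
  remain and one hitting set meets them all.\<close>

lemma thin_avoiding_set:
  fixes F :: "real set" and g K \<epsilon> :: real
  assumes "finite F" and F1: "F \<subseteq> {-1..1}"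
    and sep: "\<And>a a'. a \<in> F \<Longrightarrow> a' \<in> F \<Longrightarrow> a \<noteq> a' \<Longrightarrow> g \<le> \<bar>a - a'\<bar>"
    and g: "0 < g" "g \<le> 1" and \<epsilon>: "0 < \<epsilon>" "\<epsilon> \<le> 1" and K: "8 \<le> K * \<epsilon>"
    and large: "225 * K ^ 4 / g ^ 2 < exp (\<epsilon> * card F / 16)"
  shows "\<exists>U \<in> sets borel. emeasure lborel U \<le> ennreal \<epsilon> \<and>
    (\<forall>x t. 1 / K \<le> \<bar>t\<bar> \<and> \<bar>t\<bar> \<le> K \<longrightarrow> \<not> (\<lambda>a. x + t * a) ` F \<subseteq> {0..1} - U)"
proof -
  have K0: "K > 0"
    using K \<epsilon> mult_nonpos_nonneg[of K \<epsilon>] by linarith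
  have K8: "K \<ge> 8"
    using K \<epsilon> K0 mult_left_mono[of \<epsilon> 1 K] by linarith
  \<comment> \<open>For \<open>\<bar>t\<bar> \<ge> 1 / K\<close> this gives
    \<open>\<bar>M * t\<bar> \<ge> 2 / g\<close>, so the rounded slope still has size at least
    \<open>1 / g\<close>.\<close>
  define M where "M = \<lceil>2 * K / g\<rceil>"
  \<comment> \<open>Bounds both rounded parameters: \<open>M \<le> 3 * K / g\<close> and
    \<open>\<bar>x\<bar>\<close>, \<open>\<bar>t\<bar>\<close> are at most \<open>1 + K\<close>, so
    \<open>M * (1 + K)\<close> is at most \<open>6 * K ^ 2 / g\<close>; the rest absorbs the
    floor.\<close>
  define W where "W = \<lfloor>7 * K ^ 2 / g\<rfloor>"
  \<comment> \<open>Each chosen cell will be covered by an interval of length \<open>4 / M\<close>,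
    so \<open>m\<close> of them have total length at most \<epsilon>.\<close>
  define m where "m = nat \<lfloor>\<epsilon> * M / 4\<rfloor>"
  \<comment> \<open>The margins allow for rounding: if \<open>M * y\<close> lies between 0 and
    \<open>M\<close>, and between \<open>u - 1\<close> and \<open>u + 3\<close>, then
    \<open>u\<close> lies between -3 and \<open>M + 1\<close>.\<close>
  define G where "G = {-3..M+1}"
  define u where "u = (\<lambda>p q a. \<lfloor>real_of_int p + real_of_int q * a\<rfloor>)"
  define \<C> where "\<C> = {C \<in> (\<lambda>(p, q). u p q ` F) ` ({-W..W} \<times> {-W..W}). C \<subseteq> G \<and> card F \<le> card C}"
  have Mlow: "2 * K / g \<le> M" and Mup: "M \<le> 2 * K / g + 1"
    unfolding M_def by linarith+
  have Kg: "K \<le> K / g"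
    using g K0 by (simp add: field_simps)
  have M16: "M \<ge> 16"
    using Mlow Kg K8 by linarith
  have Mup3: "M \<le> 3 * K / g"
  proof -
    have "3 * K / g = 2 * K / g + K / g" by (simp flip: add_divide_distrib)
    then show ?thesis using Mup Kg K8 by linarith
  qed
  have Kg2: "1 \<le> K ^ 2 / g" "K / g \<le> K ^ 2 / g"
  proof -
    have "K * 1 \<le> K * K" using K8 by (intro mult_left_mono) auto
    then show "K / g \<le> K ^ 2 / g" using g by (simp add: power2_eq_square divide_right_mono)
    then show "1 \<le> K ^ 2 / g" using Kg K8 by linarith
  qed
  \<comment> \<open>Makes \<open>\<epsilon> * M / 4\<close> at least 4, so that the floor in
    \<open>m\<close> loses at most half of it.\<close>
  have M\<epsilon>: "\<epsilon> * M \<ge> 16"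
  proof -
    have "2 * K \<le> M" using Mlow Kg by simp
    then have "\<epsilon> * (2 * K) \<le> \<epsilon> * M" using \<epsilon> by (intro mult_left_mono) auto
    then show ?thesis using K by (simp only: mult.commute[of K] mult.assoc mult.left_commute[of _ 2])
  qed
  have m: "m \<le> \<epsilon> * M / 4" "\<epsilon> * M / 8 \<le> m"
  proof -
    have "real m = of_int \<lfloor>\<epsilon> * M / 4\<rfloor>"
      unfolding m_def using M\<epsilon> by simp
    then show "m \<le> \<epsilon> * M / 4" "\<epsilon> * M / 8 \<le> m"
      using M\<epsilon> by linarith+
  qed
  have cardG: "real (card G) = M + 5"
    using M16 by (simp add: G_def)
  \<comment> \<open>The drawn proportion \<open>m / card G\<close> is at least
    \<open>\<epsilon> / 16\<close>, which is the rate in \<open>large\<close>.\<close>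
  have "\<epsilon> / 16 * (M + 5) \<le> m"
  proof -
    have "\<epsilon> / 16 * (M + 5) \<le> \<epsilon> / 16 * (2 * M)"
      using \<epsilon> M16 by (intro mult_left_mono) auto
    then show ?thesis using m by simp
  qed
  then have mG: "\<epsilon> / 16 \<le> m / card G"
    using cardG M16 by (simp add: field_simps)
  have W0: "W \<ge> 0"
    using Kg2 g K0 by (simp add: W_def)
  have "card \<C> \<le> card ((\<lambda>(p, q). u p q ` F) ` ({-W..W} \<times> {-W..W}))"
    unfolding \<C>_def by (intro card_mono) auto
  also have "\<dots> \<le> card ({-W..W} \<times> {-W..W})"
    by (intro card_image_le) auto
  also have "\<dots> = (nat (2 * W + 1))\<^sup>2"
    by (simp add: card_cartesian_product power2_eq_square algebra_simps)
  finally have "real (card \<C>) \<le> real ((nat (2 * W + 1))\<^sup>2)"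
    by (simp only: of_nat_le_iff)
  also have "\<dots> = (2 * real_of_int W + 1)\<^sup>2"
    using W0 by simp
  \<comment> \<open>From \<open>2 * W + 1 \<le> (14 + 1) * (K ^ 2 / g)\<close>; squaring produces
    the constant 225.\<close>
  also have "\<dots> \<le> (15 * (K ^ 2 / g))\<^sup>2"
  proof -
    have "real_of_int W \<le> 7 * K ^ 2 / g" unfolding W_def by linarith
    then show ?thesis using Kg2 W0 by (intro power_mono) auto
  qed
  also have "\<dots> = 225 * K ^ 4 / g ^ 2"
    by (simp add: power_mult_distrib power_divide)
  also note large
  also have "exp (\<epsilon> * card F / 16) \<le> exp (card F * m / card G)"
    using mult_left_mono[OF mG, of "card F"] by (simp add: mult.commute)
  finally have few: "card \<C> < exp (card F * m / card G)" .
  have "\<exists>H \<subseteq> G. card H \<le> m \<and> (\<forall>C \<in> \<C>. C \<inter> H \<noteq> {})"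
    by (rule exists_hitting_set[OF _ _ _ _ _ few]) (use M16 in \<open>auto simp: \<C>_def G_def\<close>)
  then obtain H where H: "H \<subseteq> G" "card H \<le> m" and hit: "\<And>C. C \<in> \<C> \<Longrightarrow> C \<inter> H \<noteq> {}"
    by blast
  have finH: "finite H"
    using H(1) by (rule finite_subset) (simp add: G_def)
  \<comment> \<open>Rounding \<open>M x\<close> and \<open>M t\<close> to \<open>p\<close> and \<open>q\<close> moves \<open>M (x + t a)\<close> by less than \<open>2\<close>, and the floor in \<open>u\<close> by
    less than \<open>1\<close>, so cells are enlarged to length \<open>4 / M\<close>.\<close>
  define U where "U = (\<Union>h\<in>H. {(real_of_int h - 1) / M..(real_of_int h + 3) / M})"
  have "emeasure lborel U \<le> (\<Sum>h\<in>H. emeasure lborel {(real_of_int h - 1) / M..(real_of_int h + 3) / M})"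
    unfolding U_def using finH by (intro emeasure_subadditive_finite) auto
  also have "\<dots> = (\<Sum>h\<in>H. ennreal (4 / M))"
    using M16 by (intro sum.cong refl) (simp add: divide_right_mono flip: diff_divide_distrib)
  also have "\<dots> = ennreal (card H * (4 / M))"
    using M16 by (subst sum_ennreal) auto
  also have "\<dots> \<le> ennreal \<epsilon>"
  proof (rule ennreal_leI)
    have "card H * (4 / M) \<le> m * (4 / M)"
      using H M16 by (intro mult_right_mono) auto
    also have "\<dots> \<le> \<epsilon>"
      using m M16 by (simp add: field_simps)
    finally show "card H * (4 / M) \<le> \<epsilon>" .
  qed
  finally have U\<epsilon>: "emeasure lborel U \<le> ennreal \<epsilon>" .
  have "\<not> (\<lambda>a. x + t * a) ` F \<subseteq> {0..1} - U" if t: "1 / K \<le> \<bar>t\<bar>" "\<bar>t\<bar> \<le> K" for x t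
  proof
    assume in01: "(\<lambda>a. x + t * a) ` F \<subseteq> {0..1} - U"
    define p where "p = \<lfloor>M * x\<rfloor>"
    define q where "q = \<lfloor>M * t\<rfloor>"
    have p: "p \<le> M * x" "M * x < p + 1" and q: "q \<le> M * t" "M * t < q + 1"
      unfolding p_def q_def by linarith+
    have near: "u p q a - 1 \<le> M * (x + t * a)" "M * (x + t * a) \<le> u p q a + 3" if "a \<in> F" for a
    proof -
      have a: "\<bar>a\<bar> \<le> 1" using F1 that by (auto simp: abs_le_iff)
      have "\<bar>(M * t - q) * a\<bar> \<le> 1 * 1"
        unfolding abs_mult using a q by (intro mult_mono) auto
      then have "\<bar>M * t * a - q * a\<bar> \<le> 1"
        by (simp add: algebra_simps)
      moreover have "u p q a \<le> p + q * a" "p + q * a < u p q a + 1"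
        unfolding u_def by linarith+
      moreover have "M * (x + t * a) = M * x + M * t * a"
        by (simp add: algebra_simps)
      ultimately show "u p q a - 1 \<le> M * (x + t * a)" "M * (x + t * a) \<le> u p q a + 3"
        using p by linarith+
    qed
    have "F \<noteq> {}"
    proof
      assume "F = {}"
      then have "225 * K ^ 4 / g ^ 2 < 1" using large by simp
      moreover have "(K ^ 2 / g) ^ 2 \<ge> 1" using Kg2 by (intro one_le_power) auto
      ultimately show False by (simp add: power_divide)
    qed
    then obtain a0 where a0: "a0 \<in> F" by blast
    \<comment> \<open>One point of \<open>F\<close> already confines the translation: its image lies
      in \<open>{0..1}\<close> and \<open>\<bar>t * a0\<bar> \<le> K\<close>.\<close>
    have "\<bar>x\<bar> \<le> 1 + K"
    proof -
      have "\<bar>t * a0\<bar> \<le> K * 1"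
        unfolding abs_mult using t a0 F1 K0 by (intro mult_mono) (auto simp: abs_le_iff)
      moreover have "x + t * a0 \<in> {0..1}" using in01 a0 by auto
      ultimately show ?thesis by auto
    qed
    have MK: "M * (1 + K) + 1 \<le> 7 * K ^ 2 / g"
    proof -
      have "M * (1 + K) \<le> 3 * K / g * (2 * K)"
        using Mup3 K8 M16 by (intro mult_mono) auto
      then show ?thesis using Kg2 by (simp add: power2_eq_square)
    qed
    have box: "\<lfloor>M * y\<rfloor> \<in> {-W..W}" if "\<bar>y\<bar> \<le> 1 + K" for y :: real
    proof -
      have "\<bar>M * y\<bar> \<le> M * (1 + K)"
        unfolding abs_mult using that M16 by simp
      then have "M * y \<le> 7 * K ^ 2 / g" "- (7 * K ^ 2 / g) \<le> M * y - 1"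
        using MK by linarith+
      then show ?thesis unfolding W_def
        by (auto intro: floor_mono) linarith
    qed
    have pq: "p \<in> {-W..W}" "q \<in> {-W..W}"
      using box \<open>\<bar>x\<bar> \<le> 1 + K\<close> t unfolding p_def q_def by auto
    have "u p q ` F \<subseteq> G"
    proof safe
      fix a assume "a \<in> F"
      have "0 \<le> M * (x + t * a)" "M * (x + t * a) \<le> M * 1"
        using in01 \<open>a \<in> F\<close> M16 by (auto intro!: mult_nonneg_nonneg)
      then show "u p q a \<in> G"
        using near[OF \<open>a \<in> F\<close>] unfolding G_def by (simp only: atLeastAtMost_iff) linarith
    qed
    \<comment> \<open>Gaps of at least \<open>g\<close> are stretched by
      \<open>\<bar>q\<bar> \<ge> 1 / g\<close> to at least 1, so the floors differ.\<close>
    moreover have "inj_on (u p q) F"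
    proof (rule inj_onI, rule ccontr)
      fix a a' assume a: "a \<in> F" "a' \<in> F" "u p q a = u p q a'" "a \<noteq> a'"
      have "2 / g \<le> M / K"
        using Mlow K0 g by (simp add: field_simps)
      moreover have "M * \<bar>t\<bar> \<ge> M / K"
        using mult_left_mono[OF t(1), of M] M16 by simp
      moreover have "\<bar>M * t\<bar> = M * \<bar>t\<bar>"
        using M16 by (simp add: abs_mult)
      ultimately have "\<bar>real_of_int q\<bar> \<ge> 2 / g - 1"
        using q by linarith
      moreover have "2 / g - 1 \<ge> 1 / g"
        using g by (simp add: field_simps)
      ultimately have "\<bar>real_of_int q\<bar> \<ge> 1 / g" by linarith
      then have "1 / g * g \<le> \<bar>real_of_int q\<bar> * \<bar>a - a'\<bar>"
        using sep[OF a(1,2,4)] g by (intro mult_mono) auto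
      then have "1 \<le> \<bar>q * a - q * a'\<bar>"
        using g by (simp add: right_diff_distrib flip: abs_mult)
      then show False using a(3) unfolding u_def by linarith
    qed
    ultimately have "u p q ` F \<in> \<C>"
      using pq unfolding \<C>_def by (auto simp: card_image)
    from hit[OF this] obtain a where a: "a \<in> F" "u p q a \<in> H" by blast
    have "x + t * a \<in> {(real_of_int (u p q a) - 1) / M..(real_of_int (u p q a) + 3) / M}"
      using near[OF a(1)] M16 by (simp add: field_simps)
    then have "x + t * a \<in> U" using a unfolding U_def by blast
    then show False using in01 a(1) by blast
  qed
  moreover have "U \<in> sets borel"
    unfolding U_def using finH by auto
  ultimately show ?thesis using U\<epsilon> by blast
qed

section \<open>A criterion for failing measure universality\<close>

text \<open>The scale windows from \<open>1 / K k\<close> to \<open>K k\<close> exhaust all nonzero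
  scales, while the sets removed for them have total measure at most 1/2, so a set of positive
  measure remains in \<open>{0..1}\<close>.\<close>

lemma not_measure_universal_if_separated_subsets:
  fixes A :: "real set"
  assumes rich: "\<And>(\<eta>::real) (N::nat). \<eta> > 0 \<Longrightarrow> \<exists>F g. F \<subseteq> A \<and> finite F \<and> F \<subseteq> {-1..1} \<and> N \<le> card F \<and>
    0 < g \<and> g \<le> 1 \<and> - ln g \<le> \<eta> * card F \<and> (\<forall>a\<in>F. \<forall>a'\<in>F. a \<noteq> a' \<longrightarrow> g \<le> \<bar>a - a'\<bar>)"
  shows "\<not> measure_universal A"
proof -
  \<comment> \<open>The exponents are matched so that \<open>K k * \<epsilon> k = 8\<close> and the
    \<open>\<epsilon> k\<close> sum to 1/2.\<close>
  define \<epsilon> where "\<epsilon> k = (1/2::real) ^ (k + 2)" for k :: nat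
  define K where "K k = (2::real) ^ (k + 5)" for k :: nat
  have "\<exists>U \<in> sets borel. emeasure lborel U \<le> ennreal (\<epsilon> k) \<and>
    (\<forall>x t. 1 / K k \<le> \<bar>t\<bar> \<and> \<bar>t\<bar> \<le> K k \<longrightarrow> \<not> (\<lambda>a. x + t * a) ` A \<subseteq> {0..1} - U)" for k
  proof -
    have "\<epsilon> k \<le> 1"
      unfolding \<epsilon>_def by (intro power_le_one) auto
    then have \<epsilon>: "0 < \<epsilon> k" "\<epsilon> k \<le> 1" "8 \<le> K k * \<epsilon> k"
      by (auto simp: \<epsilon>_def K_def power_add power_divide)
    \<comment> \<open>The exponent \<open>\<epsilon> k * card F / 16\<close> is shared equally: one
      half beats \<open>ln (225 * K k ^ 4)\<close> by the choice of \<open>N\<close>, the other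
      bounds \<open>- 2 * ln g\<close> by the choice
      \<open>\<eta> = \<epsilon> k / 64\<close>.\<close>
    obtain N :: nat where N: "N > 32 / \<epsilon> k * ln (225 * K k ^ 4)"
      using reals_Archimedean2 by blast
    obtain F g where F: "F \<subseteq> A" "finite F" "F \<subseteq> {-1..1}" "N \<le> card F" and g: "0 < g" "g \<le> 1"
      and lng: "- ln g \<le> \<epsilon> k / 64 * card F"
      and sep: "\<And>a a'. a \<in> F \<Longrightarrow> a' \<in> F \<Longrightarrow> a \<noteq> a' \<Longrightarrow> g \<le> \<bar>a - a'\<bar>"
      using rich[of "\<epsilon> k / 64" N] \<epsilon>(1) by auto
    have K0: "K k > 0" by (simp add: K_def)
    have "32 / \<epsilon> k * ln (225 * K k ^ 4) < card F"
      using N F(4) by linarith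
    then have "ln (225 * K k ^ 4) < \<epsilon> k * card F / 32"
      using \<epsilon>(1) by (simp add: field_simps)
    moreover have "ln (225 * K k ^ 4 / g ^ 2) = ln (225 * K k ^ 4) - 2 * ln g"
      using K0 g by (simp add: ln_div ln_realpow)
    ultimately have "ln (225 * K k ^ 4 / g ^ 2) < \<epsilon> k * card F / 16"
      using lng by linarith
    then have "exp (ln (225 * K k ^ 4 / g ^ 2)) < exp (\<epsilon> k * card F / 16)"
      by simp
    then have large: "225 * K k ^ 4 / g ^ 2 < exp (\<epsilon> k * card F / 16)"
      using K0 g by simp
    obtain U where "U \<in> sets borel" "emeasure lborel U \<le> ennreal (\<epsilon> k)"
      "\<And>x t. 1 / K k \<le> \<bar>t\<bar> \<and> \<bar>t\<bar> \<le> K k \<Longrightarrow> \<not> (\<lambda>a. x + t * a) ` F \<subseteq> {0..1} - U"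
      using thin_avoiding_set[OF F(2,3) sep g \<epsilon> large] by blast
    then show ?thesis using F(1) by (meson image_mono order_trans)
  qed
  then obtain U where U: "\<And>k. U k \<in> sets borel" "\<And>k. emeasure lborel (U k) \<le> ennreal (\<epsilon> k)"
    and avoid: "\<And>k x t. 1 / K k \<le> \<bar>t\<bar> \<Longrightarrow> \<bar>t\<bar> \<le> K k \<Longrightarrow> \<not> (\<lambda>a. x + t * a) ` A \<subseteq> {0..1} - U k"
    by metis
  define L where "L = {0..1} - (\<Union>k. U k)"
  have L: "L \<in> sets borel"
    unfolding L_def using U(1) by auto
  have "emeasure lborel (\<Union>k. U k) \<le> (\<Sum>k. emeasure lborel (U k))"
    using U(1) by (intro emeasure_subadditive_countably) auto
  also have "\<dots> \<le> (\<Sum>k. ennreal (\<epsilon> k))"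
    using U(2) by (intro suminf_le) auto
  also have "\<dots> = ennreal (1/2)"
  proof -
    have "\<epsilon> sums (1/2)"
      using sums_mult[OF geometric_sums[of "1/2::real"], of "1/4"] by (simp add: \<epsilon>_def[abs_def] mult.commute)
    then show ?thesis
      by (intro suminf_ennreal_eq) (simp add: \<epsilon>_def)
  qed
  finally have half: "emeasure lborel (\<Union>k. U k) \<le> ennreal (1/2)" .
  have "emeasure lborel L > 0"
  proof (rule ccontr)
    assume "\<not> emeasure lborel L > 0"
    then have L0: "emeasure lborel L = 0" by simp
    have "emeasure lborel {0..1::real} \<le> emeasure lborel (L \<union> (\<Union>k. U k))"
      using L U(1) by (intro emeasure_mono) (auto simp: L_def)
    also have "\<dots> \<le> emeasure lborel L + emeasure lborel (\<Union>k. U k)"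
      using L U(1) by (intro emeasure_subadditive) auto
    finally have "ennreal 1 \<le> ennreal (1/2)"
      using half L0 by simp
    then show False by (subst (asm) ennreal_le_iff) auto
  qed
  then have "emeasure lebesgue L > 0" "L \<in> sets lebesgue"
    using L by auto
  moreover have "\<not> (\<lambda>a. x + c * a) ` A \<subseteq> L" if "c \<noteq> 0" for x c
  proof -
    obtain k where k: "(2::real) ^ k > max \<bar>c\<bar> (1 / \<bar>c\<bar>)"
      using real_arch_pow[of 2 "max \<bar>c\<bar> (1 / \<bar>c\<bar>)"] by auto
    have "2 ^ k \<le> K k"
      by (auto simp: K_def)
    then have "\<bar>c\<bar> \<le> K k" "1 / \<bar>c\<bar> \<le> K k"
      using k by auto
    then have "\<not> (\<lambda>a. x + c * a) ` A \<subseteq> {0..1} - U k"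
      using that by (intro avoid) (auto simp: K_def field_simps)
    then show ?thesis unfolding L_def by blast
  qed
  ultimately show ?thesis
    unfolding measure_universal_def by blast
qed


section \<open>Signed sums of two rapidly decreasing sequences\<close>

text \<open>The bound 1/2 keeps signed sums of two terms within \<open>{-1..1}\<close>; the factor 4
  leaves room for a perturbation by the other sequence.\<close>

definition quarter_decay :: "(nat \<Rightarrow> real) \<Rightarrow> bool" where
  "quarter_decay b \<longleftrightarrow> (\<forall>i\<ge>1. 0 < b i \<and> 4 * b (Suc i) \<le> b i \<and> b i \<le> 1/2)"

lemma quarter_decayD:
  assumes "quarter_decay b" "i \<ge> 1"
  shows "0 < b i" "b i \<le> 1/2"
  using assms by (auto simp: quarter_decay_def)

lemma quarter_decay_less:
  assumes b: "quarter_decay b" and i: "1 \<le> i" "i < j"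
  shows "4 * b j \<le> b i"
proof -
  have "Suc i \<le> j" using i by simp
  then show ?thesis
  proof (induction j rule: dec_induct)
    case base
    then show ?case using b i by (simp add: quarter_decay_def)
  next
    case (step n)
    moreover have "4 * b (Suc n) \<le> b n" "0 < b n"
      using b step i by (auto simp: quarter_decay_def)
    ultimately show ?case by simp
  qed
qed

lemma quarter_decay_antimono:
  assumes b: "quarter_decay b" and i: "1 \<le> i" "i \<le> j"
  shows "b j \<le> b i"
  using quarter_decay_less[OF b, of i j] quarter_decayD[OF b, of j] i
  by (cases "i = j") auto

text \<open>The shift of \<open>d\<close> by one index makes the \<open>d\<close>-term at most a quarter of the \<open>b\<close>-term, so that
  the sums are ordered lexicographically, whatever the signs.\<close>

lemma separated_signed_sums:
  fixes b d :: "nat \<Rightarrow> real" and s s' :: real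
  assumes b: "quarter_decay b" and d: "quarter_decay d"
    and s: "s \<in> {1, -1}" "s' \<in> {1, -1}"
    and P: "P \<subseteq> {1..N} \<times> {1..N}" and dom: "\<And>i j. (i, j) \<in> P \<Longrightarrow> d j \<le> b i"
    and A: "\<And>i j. 1 \<le> i \<Longrightarrow> 1 \<le> j \<Longrightarrow> s * b i + s' * d j \<in> A"
  shows "\<exists>F \<subseteq> A. finite F \<and> F \<subseteq> {-1..1} \<and> card F = card P \<and>
    (\<forall>a\<in>F. \<forall>a'\<in>F. a \<noteq> a' \<longrightarrow> min (b (Suc N)) (d (Suc N)) / 4 \<le> \<bar>a - a'\<bar>)"
proof -
  define f where "f = (\<lambda>(i, j). s * b i + s' * d (Suc j))"
  define g where "g = min (b (Suc N)) (d (Suc N)) / 4"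
  have g: "g > 0"
    using quarter_decayD[OF b, of "Suc N"] quarter_decayD[OF d, of "Suc N"] by (simp add: g_def)
  have lex: "g \<le> \<bar>f (i, j) - f (i', j')\<bar>"
    if p: "(i, j) \<in> P" "(i', j') \<in> P" and less: "i < i' \<or> i = i' \<and> j < j'" for i j i' j'
  proof -
    have ij: "1 \<le> i" "i \<le> N" "1 \<le> j" "j \<le> N" "1 \<le> i'" "i' \<le> N" "1 \<le> j'" "j' \<le> N"
      using p P by auto
    have pos: "0 < b i" "0 < b i'" "0 < d (Suc j)" "0 < d (Suc j')"
      using quarter_decayD(1)[OF b] quarter_decayD(1)[OF d] ij by simp_all
    have min: "b (Suc N) \<le> b i" "d (Suc N) \<le> d (Suc j)"
      using quarter_decay_antimono[OF b] quarter_decay_antimono[OF d] ij by simp_all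
    have dj: "4 * d (Suc j) \<le> b i" "4 * d (Suc j') \<le> b i'"
      using quarter_decay_less[OF d, of j "Suc j"] quarter_decay_less[OF d, of j' "Suc j'"]
        dom[OF p(1)] dom[OF p(2)] ij by linarith+
    have gle: "g \<le> b (Suc N) / 4" "g \<le> d (Suc N) / 4"
      unfolding g_def by (intro divide_right_mono; simp)+
    have diff: "f (i, j) - f (i', j') = s * (b i - b i') + s' * (d (Suc j) - d (Suc j'))"
      by (simp add: f_def algebra_simps)
    show ?thesis
    proof (cases "i < i'")
      case True
      then have "4 * b i' \<le> b i" using quarter_decay_less[OF b] ij by simp
      \<comment> \<open>The \<open>b\<close>-terms differ by at least three quarters of
        \<open>b i\<close>, the shifted \<open>d\<close>-terms by at most one quarter.\<close>
      then have "g \<le> b i - b i' - \<bar>d (Suc j) - d (Suc j')\<bar>"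
        using pos min(1) dj gle(1) by linarith
      also have "\<dots> \<le> \<bar>f (i, j) - f (i', j')\<bar>"
        unfolding diff using s by (elim insertE emptyE) auto
      finally show ?thesis .
    next
      case False
      then have "i' = i" "4 * d (Suc j') \<le> d (Suc j)"
        using less quarter_decay_less[OF d, of "Suc j" "Suc j'"] by auto
      then have "g \<le> \<bar>d (Suc j) - d (Suc j')\<bar>"
        using pos min(2) gle(2) by linarith
      also have "\<dots> \<le> \<bar>f (i, j) - f (i', j')\<bar>"
        unfolding diff using s \<open>i' = i\<close> by (elim insertE emptyE) auto
      finally show ?thesis .
    qed
  qed
  have sep: "g \<le> \<bar>f p - f p'\<bar>" if pp: "p \<in> P" "p' \<in> P" "p \<noteq> p'" for p p'
  proof -
    obtain i j i' j' where e: "p = (i, j)" "p' = (i', j')" by (cases p, cases p')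
    then consider "i < i' \<or> i = i' \<and> j < j'" | "i' < i \<or> i' = i \<and> j' < j"
      using pp by force
    then show ?thesis
      using lex[of i j i' j'] lex[of i' j' i j] pp unfolding e
      by cases (auto simp: abs_minus_commute)
  qed
  have "inj_on f P"
    using sep g by (intro inj_onI) fastforce
  have "f ` P \<subseteq> A" using A P unfolding f_def by fastforce
  moreover have "finite (f ` P)"
    using finite_subset[OF P] by simp
  moreover have "f ` P \<subseteq> {-1..1}"
  proof safe
    fix i j assume "(i, j) \<in> P"
    then have "1 \<le> i" "1 \<le> Suc j" using P by auto
    then show "f (i, j) \<in> {-1..1}"
      using quarter_decayD[OF b, of i] quarter_decayD[OF d, of "Suc j"] s by (auto simp: f_def)
  qed
  moreover have "card (f ` P) = card P"
    using \<open>inj_on f P\<close> by (rule card_image)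
  moreover have "\<forall>a\<in>f ` P. \<forall>a'\<in>f ` P. a \<noteq> a' \<longrightarrow> g \<le> \<bar>a - a'\<bar>"
    using sep by blast
  ultimately show ?thesis unfolding g_def by blast
qed

text \<open>Every pair of indices has its larger term in \<open>b\<close> or in \<open>d\<close>, so
  one of the two kinds accounts for at least half of the \<open>N^2\<close> pairs; the second kind
  is treated with the roles of \<open>b\<close> and \<open>d\<close> exchanged.\<close>

lemma large_separated_subset:
  fixes b d :: "nat \<Rightarrow> real" and s s' :: real
  assumes b: "quarter_decay b" and d: "quarter_decay d"
    and s: "s \<in> {1, -1}" "s' \<in> {1, -1}"
    and A: "\<And>i j. 1 \<le> i \<Longrightarrow> 1 \<le> j \<Longrightarrow> s * b i + s' * d j \<in> A"
  shows "\<exists>F \<subseteq> A. finite F \<and> F \<subseteq> {-1..1} \<and> N\<^sup>2 \<le> 2 * card F \<and>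
    (\<forall>a\<in>F. \<forall>a'\<in>F. a \<noteq> a' \<longrightarrow> min (b (Suc N)) (d (Suc N)) / 4 \<le> \<bar>a - a'\<bar>)"
proof -
  define P where "P = {p \<in> {1..N} \<times> {1..N}. d (snd p) \<le> b (fst p)}"
  \<comment> \<open>Here the first coordinate indexes \<open>d\<close>, hence the swap
    below.\<close>
  define Q where "Q = {p \<in> {1..N} \<times> {1..N}. b (snd p) \<le> d (fst p)}"
  have "{1..N} \<times> {1..N} \<subseteq> P \<union> prod.swap ` Q"
    by (force simp: P_def Q_def)
  then have "card ({1..N} \<times> {1..N}) \<le> card (P \<union> prod.swap ` Q)"
    by (intro card_mono) (auto simp: P_def Q_def)
  also have "\<dots> \<le> card P + card Q"
    by (intro order_trans[OF card_Un_le] add_mono card_image_le order_refl) (simp add: Q_def)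
  finally have "N\<^sup>2 \<le> card P + card Q"
    by (simp add: card_cartesian_product power2_eq_square)
  then consider "N\<^sup>2 \<le> 2 * card P" | "N\<^sup>2 \<le> 2 * card Q"
    by linarith
  then show ?thesis
  proof cases
    case 1
    have "\<exists>F \<subseteq> A. finite F \<and> F \<subseteq> {-1..1} \<and> card F = card P \<and>
      (\<forall>a\<in>F. \<forall>a'\<in>F. a \<noteq> a' \<longrightarrow> min (b (Suc N)) (d (Suc N)) / 4 \<le> \<bar>a - a'\<bar>)"
      by (rule separated_signed_sums[OF b d s]) (auto simp: P_def A)
    then show ?thesis using 1 by metis
  next
    case 2
    have "\<exists>F \<subseteq> A. finite F \<and> F \<subseteq> {-1..1} \<and> card F = card Q \<and>
      (\<forall>a\<in>F. \<forall>a'\<in>F. a \<noteq> a' \<longrightarrow> min (d (Suc N)) (b (Suc N)) / 4 \<le> \<bar>a - a'\<bar>)"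
      by (rule separated_signed_sums[OF d b s(2,1)]) (auto simp: Q_def A add.commute)
    then show ?thesis using 2 by (metis min.commute)
  qed
qed

text \<open>At least \<open>N^2 / 2\<close> points have gaps whose negative logarithm is
  \<open>o(N^2)\<close>: the number of sums is quadratic in \<open>N\<close>, which is why quadratic
  decay is the threshold.\<close>

lemma not_measure_universal_quarter_decay:
  fixes b d :: "nat \<Rightarrow> real" and s s' :: real
  assumes b: "quarter_decay b" and d: "quarter_decay d"
    and s: "s \<in> {1, -1}" "s' \<in> {1, -1}"
    and A: "\<And>i j. 1 \<le> i \<Longrightarrow> 1 \<le> j \<Longrightarrow> s * b i + s' * d j \<in> A"
    and ob: "(\<lambda>i. - ln (b i)) \<in> o(\<lambda>i. (real i)\<^sup>2)"
    and od: "(\<lambda>i. - ln (d i)) \<in> o(\<lambda>i. (real i)\<^sup>2)"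
  shows "\<not> measure_universal A"
proof (rule not_measure_universal_if_separated_subsets)
  fix \<eta> :: real and N0 :: nat
  assume \<eta>: "\<eta> > 0"
  \<comment> \<open>The terms are taken at \<open>Suc N\<close>; since
    \<open>(N + 1)^2 \<le> 4 * N^2\<close>, the constant \<open>\<eta> / 16\<close> becomes
    \<open>\<eta> / 4\<close>.\<close>
  have "\<forall>\<^sub>F n in sequentially. - ln (b n) \<le> \<eta> / 16 * (real n)\<^sup>2 \<and> - ln (d n) \<le> \<eta> / 16 * (real n)\<^sup>2"
    using eventually_conj[OF landau_o.smallD[OF ob, of "\<eta> / 16"] landau_o.smallD[OF od, of "\<eta> / 16"]] \<eta>
    by (auto elim!: eventually_mono)
  then obtain N1 where N1: "\<And>n. n \<ge> N1 \<Longrightarrow>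
      - ln (b n) \<le> \<eta> / 16 * (real n)\<^sup>2 \<and> - ln (d n) \<le> \<eta> / 16 * (real n)\<^sup>2"
    by (auto simp: eventually_sequentially)
  obtain N2 :: nat where N2: "4 * ln 4 / \<eta> < N2"
    using reals_Archimedean2 by blast
  \<comment> \<open>\<open>N1\<close> serves the asymptotics, \<open>N2\<close> absorbs the
    \<open>ln 4\<close> from the quarter in \<open>g\<close>, \<open>2 * N0\<close> makes
    \<open>F\<close> large enough, and the 1 gives \<open>N + 1 \<le> 2 * N\<close>.\<close>
  define N where "N = N1 + N2 + 2 * N0 + 1"
  have NN: "real N \<le> (real N)\<^sup>2" "N \<le> N\<^sup>2"
    by (simp_all add: N_def power2_eq_square)
  have "4 * ln 4 / \<eta> < (real N)\<^sup>2"
    using N2 NN(1) unfolding N_def by linarith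
  then have ln4: "ln 4 \<le> \<eta> * (real N)\<^sup>2 / 4"
    using \<eta> by (simp add: field_simps)
  have "(real (Suc N))\<^sup>2 \<le> (2 * real N)\<^sup>2"
    by (intro power_mono) (auto simp: N_def)
  then have "\<eta> / 16 * (real (Suc N))\<^sup>2 \<le> \<eta> / 16 * (2 * real N)\<^sup>2"
    using \<eta> by (intro mult_left_mono) auto
  then have lnN: "- ln (b (Suc N)) \<le> \<eta> * (real N)\<^sup>2 / 4" "- ln (d (Suc N)) \<le> \<eta> * (real N)\<^sup>2 / 4"
    using conjunct1[OF N1[of "Suc N"]] conjunct2[OF N1[of "Suc N"]]
    by (simp_all add: power_mult_distrib) (auto simp: N_def)
  define g where "g = min (b (Suc N)) (d (Suc N)) / 4"
  have bd: "0 < b (Suc N)" "b (Suc N) \<le> 1/2" "0 < d (Suc N)" "d (Suc N) \<le> 1/2"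
    using quarter_decayD[OF b, of "Suc N"] quarter_decayD[OF d, of "Suc N"] by auto
  then have g: "0 < g" "g \<le> 1"
    by (auto simp: g_def)
  obtain F where F: "F \<subseteq> A" "finite F" "F \<subseteq> {-1..1}" "N\<^sup>2 \<le> 2 * card F"
    "\<forall>a\<in>F. \<forall>a'\<in>F. a \<noteq> a' \<longrightarrow> g \<le> \<bar>a - a'\<bar>"
    using large_separated_subset[OF b d s A, of N] unfolding g_def by blast
  have "- ln g \<le> \<eta> * (real N)\<^sup>2 / 2"
    using bd lnN ln4 by (auto simp: g_def min_def ln_div)
  also have "\<dots> \<le> \<eta> * card F"
  proof -
    have "(real N)\<^sup>2 \<le> 2 * real (card F)"
      using F(4) by (metis of_nat_le_iff of_nat_mult of_nat_numeral of_nat_power)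
    then show ?thesis using \<eta> by simp
  qed
  finally have "- ln g \<le> \<eta> * card F" .
  moreover have "N0 \<le> card F"
    using F(4) NN(2) by (simp add: N_def)
  ultimately show "\<exists>F g. F \<subseteq> A \<and> finite F \<and> F \<subseteq> {-1..1} \<and> N0 \<le> card F \<and>
      0 < g \<and> g \<le> 1 \<and> - ln g \<le> \<eta> * card F \<and> (\<forall>a\<in>F. \<forall>a'\<in>F. a \<noteq> a' \<longrightarrow> g \<le> \<bar>a - a'\<bar>)"
    using F g by blast
qed

section \<open>Thinning lacunary sequences\<close>

text \<open>Keeping every \<open>m\<close>-th term improves the ratio \<open>q\<close> to
  \<open>q ^ m\<close>, while the growth condition only changes by the constant factor
  \<open>m^2\<close>.\<close>

lemma lacunary_subsequence_quarter_decay: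
  assumes "lacunary b" and ob: "(\<lambda>i. - ln (b i)) \<in> o(\<lambda>i. (real i)\<^sup>2)"
  obtains m where "m \<ge> 1" "quarter_decay (\<lambda>i. b (m * i))"
    "(\<lambda>i. - ln (b (m * i))) \<in> o(\<lambda>i. (real i)\<^sup>2)"
proof -
  obtain q where q: "0 < q" "q < 1" and pos: "\<And>i. i \<ge> 1 \<Longrightarrow> b i > 0"
    and ratio: "\<And>i. i \<ge> 1 \<Longrightarrow> b (Suc i) \<le> q * b i"
    using assms by (auto simp: lacunary_def lacunary_with_ratio_def)
  have decay: "b (i + n) \<le> q ^ n * b i" if "i \<ge> 1" for i n
  proof (induction n)
    case (Suc n)
    have "b (i + Suc n) \<le> q * b (i + n)"
      using ratio[of "i + n"] that by simp
    also have "\<dots> \<le> q * (q ^ n * b i)"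
      using Suc q by (intro mult_left_mono) auto
    finally show ?case by simp
  qed simp
  \<comment> \<open>The first entry secures the ratio, the second brings all kept terms below
    1/2.\<close>
  have "0 < min (1/4) (1 / (2 * b 1))"
    using pos[of 1] by simp
  then obtain n where n: "q ^ n < min (1/4) (1 / (2 * b 1))"
    using real_arch_pow_inv q by blast
  \<comment> \<open>From \<open>b 1\<close> to \<open>b (m * i)\<close> there are only
    \<open>m * i - 1\<close> steps; the successor makes this at least \<open>n\<close>, already for
    \<open>i = 1\<close>.\<close>
  define m where "m = Suc n"
  have "b (m * i) \<le> 1/2" if "i \<ge> 1" for i
  proof -
    have mi: "n \<le> m * i - 1" "1 + (m * i - 1) = m * i"
      using that by (cases i; simp add: m_def)+
    have "b (m * i) \<le> q ^ (m * i - 1) * b 1"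
      using decay[of 1 "m * i - 1"] mi by simp
    also have "\<dots> \<le> q ^ n * b 1"
      using q mi pos[of 1] by (intro mult_right_mono power_decreasing) auto
    also have "\<dots> \<le> 1 / (2 * b 1) * b 1"
      using n pos[of 1] by (intro mult_right_mono) auto
    finally show ?thesis using pos[of 1] by simp
  qed
  moreover have "4 * b (m * Suc i) \<le> b (m * i)" if "i \<ge> 1" for i
  proof -
    have mi: "m * i \<ge> 1" using that by (simp add: m_def)
    have "q ^ m \<le> q ^ n"
      using q by (intro power_decreasing) (auto simp: m_def)
    then have "q ^ m * b (m * i) \<le> 1/4 * b (m * i)"
      using n pos[OF mi] by (intro mult_right_mono) auto
    then show ?thesis
      using decay[OF mi, of m] by (simp add: add.commute)
  qed
  ultimately have "quarter_decay (\<lambda>i. b (m * i))"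
    using pos by (simp add: quarter_decay_def m_def del: mult_Suc mult_Suc_right)
  moreover have "filterlim (\<lambda>i. m * i) at_top sequentially"
    by (intro filterlim_subseq strict_monoI) (simp add: m_def del: mult_Suc)
  then have "(\<lambda>i. - ln (b (m * i))) \<in> o(\<lambda>i. (real (m * i))\<^sup>2)"
    using landau_o.small.compose[OF ob] by blast
  then have "(\<lambda>i. - ln (b (m * i))) \<in> o(\<lambda>i. (real i)\<^sup>2)"
    by (simp add: power_mult_distrib m_def del: mult_Suc of_nat_Suc)
  ultimately show thesis
    using that[of m] by (simp add: m_def)
qed

text \<open>Free signs cover sums, differences and geometric sequences with a negative factor at
  once. The two sequences may be thinned by different steps, since \<open>A\<close> contains the
  signed sums for all pairs of indices.\<close>

lemma not_measure_universal_signed_sums: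
  fixes b d :: "nat \<Rightarrow> real" and s s' :: real
  assumes b: "lacunary b" "(\<lambda>i. - ln (b i)) \<in> o(\<lambda>i. (real i)\<^sup>2)"
    and d: "lacunary d" "(\<lambda>i. - ln (d i)) \<in> o(\<lambda>i. (real i)\<^sup>2)"
    and s: "s \<in> {1, -1}" "s' \<in> {1, -1}"
    and A: "\<And>i j. 1 \<le> i \<Longrightarrow> 1 \<le> j \<Longrightarrow> s * b i + s' * d j \<in> A"
  shows "\<not> measure_universal A"
proof -
  obtain m where m: "m \<ge> 1" "quarter_decay (\<lambda>i. b (m * i))"
    "(\<lambda>i. - ln (b (m * i))) \<in> o(\<lambda>i. (real i)\<^sup>2)"
    using lacunary_subsequence_quarter_decay[OF b] .
  obtain n where n: "n \<ge> 1" "quarter_decay (\<lambda>i. d (n * i))"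
    "(\<lambda>i. - ln (d (n * i))) \<in> o(\<lambda>i. (real i)\<^sup>2)"
    using lacunary_subsequence_quarter_decay[OF d] .
  show ?thesis
    by (rule not_measure_universal_quarter_decay[OF m(2) n(2) s _ m(3) n(3)]) (use m n A in simp)
qed

lemma not_measure_universal_sum_and_difference:
  assumes "lacunary b" "(\<lambda>i. - ln (b i)) \<in> o(\<lambda>i. (real i)\<^sup>2)"
    and "lacunary d" "(\<lambda>i. - ln (d i)) \<in> o(\<lambda>i. (real i)\<^sup>2)"
    and S: "\<And>i. i \<ge> 1 \<Longrightarrow> b i \<in> S1" "\<And>j. j \<ge> 1 \<Longrightarrow> d j \<in> S2"
  shows "\<not> measure_universal (S1 + S2)" "\<not> measure_universal (difference_set S1 S2)"
proof -
  show "\<not> measure_universal (S1 + S2)"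
    by (rule not_measure_universal_signed_sums[OF assms(1-4), of 1 1]) (simp_all add: set_plus_intro S)
  show "\<not> measure_universal (difference_set S1 S2)"
    by (rule not_measure_universal_signed_sums[OF assms(1-4), of 1 "-1"])
      (auto simp: difference_set_def simp del: One_nat_def, metis S)
qed

section \<open>Geometric and stretched exponential sequences\<close>

text \<open>Even exponents alone suffice: they give the positive lacunary sequence
  \<open>\<bar>a\<bar> * (r^2) ^ n\<close> even for negative \<open>r\<close>, and the sign of
  \<open>a\<close> becomes the sign of both summands.\<close>

lemma not_measure_universal_geometric:
  fixes a r :: real
  assumes "a \<noteq> 0" "0 < \<bar>r\<bar>" "\<bar>r\<bar> < 1"
  shows "\<not> measure_universal ({a * r ^ n | n :: nat. n \<ge> 1} + {a * r ^ n | n :: nat. n \<ge> 1})"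
proof -
  define b where "b n = \<bar>a\<bar> * (r\<^sup>2) ^ n" for n
  have r2: "0 < r\<^sup>2" "r\<^sup>2 < 1"
    using assms by (auto simp: abs_square_less_1)
  have "lacunary b"
    unfolding lacunary_def lacunary_with_ratio_def using r2 assms
    by (intro exI[of _ "r\<^sup>2"]) (auto simp: b_def)
  moreover have "(\<lambda>n. - ln (b n)) \<in> o(\<lambda>n. (real n)\<^sup>2)"
  proof -
    have "- ln (b n) = - ln \<bar>a\<bar> + (- ln (r\<^sup>2)) * real n" for n
      unfolding b_def using assms r2 by (simp add: ln_mult ln_realpow)
    then show ?thesis by simp real_asymp
  qed
  moreover have "sgn a * b i + sgn a * b j \<in> {a * r ^ n | n :: nat. n \<ge> 1} + {a * r ^ n | n :: nat. n \<ge> 1}"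
    if "1 \<le> i" "1 \<le> j" for i j
  proof -
    have "sgn a * b k = a * r ^ (2 * k)" for k
      by (simp add: b_def power_mult sgn_mult_abs flip: mult.assoc)
    then show ?thesis
      using that by (auto intro!: set_plus_intro exI[of _ "2 * _"])
  qed
  ultimately show ?thesis
    using assms(1) by (intro not_measure_universal_signed_sums[of b b "sgn a" "sgn a"]) (auto simp: sgn_if)
qed

text \<open>The fractions \<open>x / (x + 1)\<close> and \<open>1 / (x + 1)\<close> add up to 1, and
  raising a number between 0 and 1 to a power \<alpha> \<le> 1 does not decrease it.\<close>

lemma powr_plus_one_le:
  fixes x \<alpha> :: real
  assumes "0 < x" "0 < \<alpha>" "\<alpha> \<le> 1"
  shows "(x + 1) powr \<alpha> \<le> x powr \<alpha> + 1"
proof -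
  have "(x / (x + 1)) powr 1 \<le> (x / (x + 1)) powr \<alpha>" "(1 / (x + 1)) powr 1 \<le> (1 / (x + 1)) powr \<alpha>"
    using assms by (intro powr_mono'; simp)+
  moreover have "x / (x + 1) + 1 / (x + 1) = 1"
    using assms by (simp flip: add_divide_distrib)
  ultimately have "1 \<le> x powr \<alpha> / (x + 1) powr \<alpha> + 1 / (x + 1) powr \<alpha>"
    using assms by (simp add: powr_divide)
  then show ?thesis
    using assms by (simp add: field_simps)
qed

text \<open>The same two fractions do not increase under a power \<alpha> \<ge> 1.\<close>

lemma powr_plus_one_ge:
  fixes x \<alpha> :: real
  assumes "0 < x" "1 \<le> \<alpha>"
  shows "x powr \<alpha> + 1 \<le> (x + 1) powr \<alpha>"
proof -
  have "(x / (x + 1)) powr \<alpha> \<le> (x / (x + 1)) powr 1" "(1 / (x + 1)) powr \<alpha> \<le> (1 / (x + 1)) powr 1"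
    using assms by (intro powr_mono'; simp)+
  moreover have "x / (x + 1) + 1 / (x + 1) = 1"
    using assms by (simp flip: add_divide_distrib)
  ultimately have "x powr \<alpha> / (x + 1) powr \<alpha> + 1 / (x + 1) powr \<alpha> \<le> 1"
    using assms by (simp add: powr_divide)
  then show ?thesis
    using assms by (simp add: field_simps)
qed

lemma not_measure_universal_stretched:
  fixes \<alpha> :: real
  assumes \<alpha>: "0 < \<alpha>" "\<alpha> < 2"
  shows "\<not> measure_universal ({2 powr (- (real n powr \<alpha>)) | n :: nat. n \<ge> 1} +
                            {2 powr (- (real n powr \<alpha>)) | n :: nat. n \<ge> 1})"
    (is "\<not> measure_universal (?S + ?S)")
proof -
  \<comment> \<open>The sequence itself is not lacunary when \<open>\<alpha> < 1\<close>; the indices \<open>\<nu> k\<close> select a subsequence that is.\<close>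
  have "\<exists>\<nu> :: nat \<Rightarrow> nat. (\<forall>k\<ge>1. 1 \<le> \<nu> k \<and> real (\<nu> k) powr \<alpha> + 1 \<le> real (\<nu> (Suc k)) powr \<alpha>) \<and>
      (\<lambda>k. real (\<nu> k) powr \<alpha>) \<in> o(\<lambda>k. (real k)\<^sup>2)"
  proof (cases "\<alpha> \<le> 1")
    case True
    \<comment> \<open>Rounding up moves the \<alpha>-th power from \<open>2 * k\<close> by at most
      1, by subadditivity; the factor 2 thus leaves a gap of at least 1 before
      \<open>2 * (k + 1)\<close>.\<close>
    define \<nu> where "\<nu> k = nat \<lceil>(2 * real k) powr (1 / \<alpha>)\<rceil>" for k :: nat
    have \<nu>: "1 \<le> \<nu> k" "2 * real k \<le> real (\<nu> k) powr \<alpha>" "real (\<nu> k) powr \<alpha> \<le> 2 * real k + 1"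
      if k: "k \<ge> 1" for k
    proof -
      define y where "y = (2 * real k) powr (1 / \<alpha>)"
      have y: "y > 0" "y powr \<alpha> = 2 * real k"
        using k \<alpha> by (auto simp: y_def powr_powr)
      have \<nu>y: "y \<le> \<nu> k" "\<nu> k \<le> y + 1"
        using y(1) unfolding \<nu>_def y_def[symmetric] by linarith+
      then show "1 \<le> \<nu> k" using y(1) by (simp add: Suc_le_eq flip: of_nat_0_less_iff)
      show "2 * real k \<le> real (\<nu> k) powr \<alpha>"
        using powr_mono2[of \<alpha> y "\<nu> k"] \<nu>y y \<alpha> by simp
      have "real (\<nu> k) powr \<alpha> \<le> (y + 1) powr \<alpha>"
        using \<nu>y \<alpha> by (intro powr_mono2) auto
      also have "\<dots> \<le> 2 * real k + 1"
        using powr_plus_one_le[OF y(1) \<alpha>(1) True] y(2) by simp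
      finally show "real (\<nu> k) powr \<alpha> \<le> 2 * real k + 1" .
    qed
    have "(\<lambda>k. real (\<nu> k) powr \<alpha>) \<in> O(\<lambda>k. 2 * real k + 1)"
      by (rule bigoI[of _ 1], rule eventually_mono[OF eventually_ge_at_top[of 1]]) (use \<nu> in auto)
    also have "(\<lambda>k. 2 * real k + 1) \<in> o(\<lambda>k. (real k)\<^sup>2)"
      by real_asymp
    finally have o: "(\<lambda>k. real (\<nu> k) powr \<alpha>) \<in> o(\<lambda>k. (real k)\<^sup>2)" .
    have "real (\<nu> k) powr \<alpha> + 1 \<le> real (\<nu> (Suc k)) powr \<alpha>" if "k \<ge> 1" for k
      using \<nu>(3)[OF that] \<nu>(2)[of "Suc k"] by simp
    then show ?thesis using o \<nu>(1) by blast
  next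
    case False
    have "(\<lambda>k. real k powr \<alpha>) \<in> o(\<lambda>k. real k powr 2)"
      using \<alpha> by (subst powr_smallo_iff) (auto intro: filterlim_real_sequentially)
    also have "(\<lambda>k. real k powr 2) = (\<lambda>k. (real k)\<^sup>2)"
      by simp
    finally have "(\<lambda>k. real k powr \<alpha>) \<in> o(\<lambda>k. (real k)\<^sup>2)" .
    then show ?thesis
      using False by (intro exI[of _ id]) (auto simp: add.commute[of 1] intro!: powr_plus_one_ge)
  qed
  then obtain \<nu> :: "nat \<Rightarrow> nat" where \<nu>: "\<And>k. k \<ge> 1 \<Longrightarrow> 1 \<le> \<nu> k"
      "\<And>k. k \<ge> 1 \<Longrightarrow> real (\<nu> k) powr \<alpha> + 1 \<le> real (\<nu> (Suc k)) powr \<alpha>"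
    and o: "(\<lambda>k. real (\<nu> k) powr \<alpha>) \<in> o(\<lambda>k. (real k)\<^sup>2)"
    by blast
  define b where "b k = 2 powr (- (real (\<nu> k) powr \<alpha>))" for k
  \<comment> \<open>The exponents grow by at least 1 per step, so the terms at least halve.\<close>
  have "b (Suc k) \<le> 1/2 * b k" if "k \<ge> 1" for k
  proof -
    have "b (Suc k) \<le> 2 powr (- 1 + - (real (\<nu> k) powr \<alpha>))"
      unfolding b_def using \<nu>(2)[OF that] by (intro powr_mono) auto
    also have "\<dots> = 1/2 * b k"
      unfolding b_def by (subst powr_add) (simp add: powr_minus)
    finally show ?thesis .
  qed
  then have "lacunary b"
    unfolding lacunary_def lacunary_with_ratio_def
    by (intro exI[of _ "1/2"]) (auto simp: b_def)
  moreover have "(\<lambda>k. - ln (b k)) \<in> o(\<lambda>k. (real k)\<^sup>2)"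
    using o by (simp add: b_def ln_powr)
  moreover have "b k \<in> ?S" if "k \<ge> 1" for k
    using \<nu>(1)[OF that] by (auto simp: b_def)
  ultimately show ?thesis
    by (intro not_measure_universal_sum_and_difference(1)) auto
qed

theorem corollary5:
  shows
   "(\<forall>(S1 :: real set) (S2 :: real set) (b :: nat \<Rightarrow> real) (d :: nat \<Rightarrow> real).
       lacunary b \<and> lacunary d \<and>
       (\<forall>i\<ge>1. b i \<in> S1) \<and> (\<forall>j\<ge>1. d j \<in> S2) \<and>
       (\<lambda>i. - ln (b i)) \<in> o(\<lambda>i. (real i)\<^sup>2) \<and>
       (\<lambda>j. - ln (d j)) \<in> o(\<lambda>j. (real j)\<^sup>2) \<longrightarrow>
       \<not> measure_universal (S1 + S2) \<and> \<not> measure_universal (difference_set S1 S2)) \<and>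
    (\<forall>(S :: real set) (b :: nat \<Rightarrow> real).
       lacunary b \<and> (\<forall>k\<ge>1. b k \<in> S) \<and>
       (\<lambda>k. - ln (b k)) \<in> o(\<lambda>k. (real k)\<^sup>2) \<longrightarrow>
       \<not> measure_universal (S + S) \<and> \<not> measure_universal (difference_set S S)) \<and>
    (\<forall>(a :: real) (r :: real).
       a \<noteq> 0 \<and> 0 < \<bar>r\<bar> \<and> \<bar>r\<bar> < 1 \<longrightarrow>
       \<not> measure_universal ({a * r ^ n | n :: nat. n \<ge> 1} + {a * r ^ n | n :: nat. n \<ge> 1})) \<and>
    (\<forall>\<alpha> :: real.
       0 < \<alpha> \<and> \<alpha> < 2 \<longrightarrow>
       \<not> measure_universal ({2 powr (- (real n powr \<alpha>)) | n :: nat. n \<ge> 1} +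
                            {2 powr (- (real n powr \<alpha>)) | n :: nat. n \<ge> 1}))"
  by (intro conjI allI impI; (elim conjE)?)
    (simp_all add: not_measure_universal_sum_and_difference not_measure_universal_geometric
      not_measure_universal_stretched del: One_nat_def)

end
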